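(* Let $1\le k\le n$ be integers. Let $\Phi$ be the map that sends a uniquely $k$-determined $n$-permutation $\pi$ to the directed hamiltonian path in $\mathcal{G}_{n,n}$ corresponding to the inverse permutation $\pi^{-1}$. Then $\Phi$ is a bijection between the set of all uniquely $k$-determined $n$-permutations and the set of all directed hamiltonian paths in $\mathcal{G}_{k,n}$.
   Context: An $n$-permutation is a permutation of $\{1,\ldots,n\}$ written as a word $\pi=\pi_1\pi_2\ldots\pi_n$. The pattern formed by a word of $k$ distinct integers is the unique $k$-permutation order-isomorphic to it. Graph of patterns overlaps $\mathcal{P}_k$: its nodes are all $k!$ $k$-permutations, and there is an arc from $a_1\ldots a_k$ to $b_1\ldots b_k$ if and only if $a_2\ldots a_k$ and $b_1\ldots b_{k-1}$ form the same pattern. For $n\ge k$, the path in $\mathcal{P}_k$ corresponding to an $n$-permutation $\pi$ is the sequence of $n-k+1$ nodes whose $i$-th term is the pattern formed by $\pi_i\pi_{i+1}\ldots\pi_{i+k-1}$, $i=1,\ldots,n-k+1$. An $n$-permutation $\pi$ is uniquely $k$-determined if no other $n$-permutation has the same corresponding path in $\mathcal{P}_k$. For $M\subseteq V=\{1,\ldots,n\}$, the path-scheme $P(n,M)$ is the graph with vertex set $V$ and edge set $\{(x,y) : |x-y|\in M\}$. For $k\le n$ put $\mathcal{G}_{k,n}=P(n,\{1,2,\ldots,k-1\})$; it is a subgraph of $\mathcal{G}_{n,n}$ (which is the complete graph on $V$). A directed hamiltonian path in such a graph is a sequence $(v_1,\ldots,v_n)$ listing every vertex exactly once with consecutive vertices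 adjacent (a path and its reversal count as different when $n\geq 2$). The directed hamiltonian path in $\mathcal{G}_{n,n}$ corresponding to an $n$-permutation $\sigma=\sigma_1\ldots\sigma_n$ is the one that starts at $\sigma_1$, then goes to $\sigma_2$, then to $\sigma_3$, and so on. *)

theory Defs
  imports "Graph_Theory.Graph_Theory" "HOL-Combinatorics.Permutations"
begin

text \<open>
  An $n$-permutation is a function \<^term>\<open>\<pi> :: nat \<Rightarrow> nat\<close> with \<^prop>\<open>\<pi> permutes {1..n}\<close>
  (so it is the identity outside \<^term>\<open>{1..n}\<close>, and equality of $n$-permutations is equality of
  functions).  List positions are counted from 0, the entries of $\pi$ from 1.
\<close>

definition perm_word :: "nat \<Rightarrow> (nat \<Rightarrow> nat) \<Rightarrow> nat list" where
  "perm_word n \<pi> = map \<pi> [1..<n+1]"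

definition order_isomorphic :: "nat list \<Rightarrow> nat list \<Rightarrow> bool" where
  "order_isomorphic u v \<longleftrightarrow> length u = length v \<and>
     (\<forall>i<length u. \<forall>j<length u. u ! i < u ! j \<longleftrightarrow> v ! i < v ! j)"

definition pattern_of :: "nat list \<Rightarrow> (nat \<Rightarrow> nat)" where
  "pattern_of w =
     (THE \<tau>. \<tau> permutes {1..length w} \<and> order_isomorphic (perm_word (length w) \<tau>) w)"

definition overlap_graph :: "nat \<Rightarrow> (nat \<Rightarrow> nat) pair_pre_digraph" where
  "overlap_graph k =
     \<lparr> pverts = {\<tau>. \<tau> permutes {1..k}},
       parcs = {(a, b). a permutes {1..k} \<and> b permutes {1..k} \<and>
                  pattern_of (tl (perm_word k a)) = pattern_of (butlast (perm_word k b))} \<rparr>"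

definition overlap_path :: "nat \<Rightarrow> nat \<Rightarrow> (nat \<Rightarrow> nat) \<Rightarrow> (nat \<Rightarrow> nat) list" where
  "overlap_path k n \<pi> = map (\<lambda>i. pattern_of (map \<pi> [i..<i+k])) [1..<n-k+2]"

definition uniquely_determined :: "nat \<Rightarrow> nat \<Rightarrow> (nat \<Rightarrow> nat) \<Rightarrow> bool" where
  "uniquely_determined k n \<pi> \<longleftrightarrow> \<pi> permutes {1..n} \<and>
     \<not> (\<exists>\<sigma>. \<sigma> permutes {1..n} \<and> \<sigma> \<noteq> \<pi> \<and> overlap_path k n \<sigma> = overlap_path k n \<pi>)"

text \<open>Undirected graphs are symmetric digraphs, following the convention of the graph library.\<close>

definition path_scheme :: "nat \<Rightarrow> nat set \<Rightarrow> nat pair_pre_digraph" where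
  "path_scheme n M =
     \<lparr> pverts = {1..n},
       parcs = {(x, y). x \<in> {1..n} \<and> y \<in> {1..n} \<and> nat \<bar>int x - int y\<bar> \<in> M} \<rparr>"

definition path_graph :: "nat \<Rightarrow> nat \<Rightarrow> nat pair_pre_digraph" where
  "path_graph k n = path_scheme n {1..k-1}"

definition directed_hamiltonian_path :: "'a pair_pre_digraph \<Rightarrow> 'a list \<Rightarrow> bool" where
  "directed_hamiltonian_path G p \<longleftrightarrow> vpath p (with_proj G) \<and> set p = pverts G"

text \<open>
  The hamiltonian path of \<^term>\<open>path_graph n n\<close> that visits $\sigma_1, \sigma_2, \ldots, \sigma_n$ in
  this order is, as a vertex sequence, the word of $\sigma$.
\<close>

definition corresponding_path :: "nat \<Rightarrow> (nat \<Rightarrow> nat) \<Rightarrow> nat list" where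
  "corresponding_path n \<sigma> = perm_word n \<sigma>"

definition Phi :: "nat \<Rightarrow> (nat \<Rightarrow> nat) \<Rightarrow> nat list" where
  "Phi n \<pi> = corresponding_path n (inv \<pi>)"


text \<open>The definite description in \<^const>\<open>pattern_of\<close> is justified on words of distinct letters.\<close>

lemma order_isomorphic_perm_word_iff:
  "order_isomorphic (perm_word (length w) \<tau>) w \<longleftrightarrow>
     (\<forall>i\<in>{1..length w}. \<forall>j\<in>{1..length w}. \<tau> i < \<tau> j \<longleftrightarrow> w ! (i-1) < w ! (j-1))"
  (is "?L \<longleftrightarrow> ?R")
proof
  assume L: ?L
  show ?R
  proof (intro ballI)
    fix i j assume ij: "i \<in> {1..length w}" "j \<in> {1..length w}"
    then obtain i' j' where "i = Suc i'" "j = Suc j'" "i' < length w" "j' < length w"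
      by (cases i; cases j) auto
    with L show "\<tau> i < \<tau> j \<longleftrightarrow> w ! (i-1) < w ! (j-1)"
      unfolding order_isomorphic_def perm_word_def
      by (simp del: upt_Suc)
  qed
next
  assume R: ?R
  show ?L
    unfolding order_isomorphic_def perm_word_def
  proof (simp del: upt_Suc, intro allI impI)
    fix i j assume "i < length w" "j < length w"
    then show "\<tau> (Suc i) < \<tau> (Suc j) \<longleftrightarrow> w ! i < w ! j"
      using R[rule_format, of "Suc i" "Suc j"] by auto
  qed
qed

lemma permutes_rank:
  assumes "\<tau> permutes {1..k::nat}" "i \<in> {1..k}"
  shows "\<tau> i = card {j \<in> {1..k}. \<tau> j \<le> \<tau> i}"
proof -
  have "\<tau> ` {j \<in> {1..k}. \<tau> j \<le> \<tau> i} = {m \<in> {1..k}. m \<le> \<tau> i}"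
  proof -
    have "\<tau> ` {j \<in> A. \<tau> j \<le> b} = {m \<in> \<tau> ` A. m \<le> b}" for A b by auto
    then show ?thesis by (simp only: permutes_image[OF assms(1)])
  qed
  moreover have "{m \<in> {1..k}. m \<le> \<tau> i} = {1..\<tau> i}"
    using permutes_in_image[OF assms(1), of i] assms(2) by auto
  moreover have "card (\<tau> ` {j \<in> {1..k}. \<tau> j \<le> \<tau> i}) = card {j \<in> {1..k}. \<tau> j \<le> \<tau> i}"
    by (rule card_image) (rule inj_on_subset[OF permutes_inj[OF assms(1)]], simp)
  ultimately show ?thesis by simp
qed

lemma ex1_pattern:
  assumes "distinct w"
  shows "\<exists>!\<tau>. \<tau> permutes {1..length w} \<and> order_isomorphic (perm_word (length w) \<tau>) w"
proof (rule ex_ex1I)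
  let ?k = "length w"
  let ?S = "\<lambda>i. {j \<in> {1..?k}. w ! (j-1) \<le> w ! (i-1)}"
  define f where "f i = (if i \<in> {1..?k} then card (?S i) else i)" for i
  have mono: "f i < f j" if "i \<in> {1..?k}" "j \<in> {1..?k}" "w ! (i-1) < w ! (j-1)" for i j
  proof -
    have "?S i \<subseteq> ?S j" using that(3) by auto
    moreover have "j \<in> ?S j" "j \<notin> ?S i" using that(2,3) by auto
    ultimately have "?S i \<subset> ?S j" by blast
    then show ?thesis using that unfolding f_def by (simp add: psubset_card_mono)
  qed
  have ne: "w ! (i-1) \<noteq> w ! (j-1)" if "i \<in> {1..?k}" "j \<in> {1..?k}" "i \<noteq> j" for i j
    using that assms by (auto simp: nth_eq_iff_index_eq)
  have iff: "f i < f j \<longleftrightarrow> w ! (i-1) < w ! (j-1)"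
    if "i \<in> {1..?k}" "j \<in> {1..?k}" for i j
    using mono[OF that] mono[OF that(2,1)] ne[OF that] by (metis linorder_neqE_nat order_less_asym)
  have inj: "inj_on f {1..?k}"
    by (rule inj_onI) (metis iff ne linorder_neqE_nat less_irrefl)
  have "f i \<in> {1..?k}" if "i \<in> {1..?k}" for i
  proof -
    have "card (?S i) \<le> card {1..?k}" by (rule card_mono) auto
    moreover have "i \<in> ?S i" using that by simp
    then have "card (?S i) > 0" by (auto simp: card_gt_0_iff)
    ultimately show ?thesis using that by (simp add: f_def)
  qed
  then have "f ` {1..?k} \<subseteq> {1..?k}" by blast
  then have "bij_betw f {1..?k} {1..?k}"
    using inj by (simp add: bij_betw_def endo_inj_surj)
  then have "f permutes {1..?k}"
    by (rule bij_imp_permutes) (auto simp: f_def)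
  with iff show "\<exists>\<tau>. \<tau> permutes {1..?k} \<and> order_isomorphic (perm_word ?k \<tau>) w"
    unfolding order_isomorphic_perm_word_iff by blast
next
  let ?k = "length w"
  fix \<tau> \<sigma>
  assume t: "\<tau> permutes {1..?k} \<and> order_isomorphic (perm_word ?k \<tau>) w"
    and s: "\<sigma> permutes {1..?k} \<and> order_isomorphic (perm_word ?k \<sigma>) w"
  have "\<tau> i = \<sigma> i" for i
  proof (cases "i \<in> {1..?k}")
    case True
    have "{j \<in> {1..?k}. \<tau> j \<le> \<tau> i} = {j \<in> {1..?k}. \<sigma> j \<le> \<sigma> i}"
      using t s True unfolding order_isomorphic_perm_word_iff not_less[symmetric] by blast
    then show ?thesis using permutes_rank[of \<tau> ?k i] permutes_rank[of \<sigma> ?k i] t s True by simp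
  next
    case False
    then show ?thesis using t s by (metis permutes_not_in)
  qed
  then show "\<tau> = \<sigma>" by blast
qed

lemma pattern_of_props:
  assumes "distinct w"
  shows "pattern_of w permutes {1..length w}"
    and "order_isomorphic (perm_word (length w) (pattern_of w)) w"
  using theI'[OF ex1_pattern[OF assms]] unfolding pattern_of_def by auto

lemma pattern_of_cong:
  assumes "order_isomorphic u v"
  shows "pattern_of u = pattern_of v"
proof -
  have "order_isomorphic x u \<longleftrightarrow> order_isomorphic x v" for x
    using assms unfolding order_isomorphic_def by auto
  then show ?thesis using assms unfolding pattern_of_def order_isomorphic_def by simp
qed


text \<open>\<^const>\<open>overlap_path\<close> is a walk in \<^const>\<open>overlap_graph\<close>.\<close>

lemma vwalk_arcs_map_upt:
  "set (vwalk_arcs (map f [a..<b])) = (\<lambda>i. (f i, f (Suc i))) ` {a..<b-1}"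
proof (induction "b - a" arbitrary: a)
  case 0
  then show ?case by simp
next
  case (Suc m)
  then have ab: "a < b" by simp
  show ?case
  proof (cases "Suc a < b")
    case True
    then have "[a..<b] = a # Suc a # [Suc (Suc a)..<b]" "[Suc a..<b] = Suc a # [Suc (Suc a)..<b]"
      by (simp_all add: upt_conv_Cons)
    moreover have "{a..<b-1} = insert a {Suc a..<b-1}" using True by auto
    ultimately show ?thesis using Suc(1)[of "Suc a"] Suc(2) by simp
  next
    case False
    with ab have "b = Suc a" by simp
    then show ?thesis by simp
  qed
qed

lemma vwalk_overlap_path:
  assumes "1 \<le> k" "k \<le> n" "\<pi> permutes {1..n}"
  shows "vwalk (overlap_path k n \<pi>) (with_proj (overlap_graph k))"
proof
  let ?w = "\<lambda>i. map \<pi> [i..<i+k]"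
  have dist: "distinct (?w i)" for i
    using permutes_inj[OF assms(3)] by (auto simp: distinct_map intro: inj_on_subset)
  have len: "length (?w i) = k" for i by simp
  have node: "pattern_of (?w i) permutes {1..k}" for i
    using pattern_of_props(1)[OF dist[of i]] unfolding len .
  have iso: "order_isomorphic (perm_word k (pattern_of (?w i))) (?w i)" for i
    using pattern_of_props(2)[OF dist[of i]] unfolding len .
  have tl: "order_isomorphic (tl u) (tl v)" if "order_isomorphic u v" for u v
    using that unfolding order_isomorphic_def by (auto simp: nth_tl)
  have bl: "order_isomorphic (butlast u) (butlast v)" if "order_isomorphic u v" for u v
    using that unfolding order_isomorphic_def by (auto simp: nth_butlast)
  have "tl (?w i) = butlast (?w (Suc i))" for i
    using assms(1) by (simp add: map_tl[symmetric] map_butlast[symmetric])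
  then have "pattern_of (tl (perm_word k (pattern_of (?w i)))) =
             pattern_of (butlast (perm_word k (pattern_of (?w (Suc i)))))" for i
    using pattern_of_cong[OF tl[OF iso[of i]]] pattern_of_cong[OF bl[OF iso[of "Suc i"]]] by simp
  then show "set (vwalk_arcs (overlap_path k n \<pi>)) \<subseteq> arcs_ends (with_proj (overlap_graph k))"
    using node node[of "Suc i" for i] unfolding overlap_path_def vwalk_arcs_map_upt overlap_graph_def
    by (auto simp del: upt_Suc)
  show "set (overlap_path k n \<pi>) \<subseteq> verts (with_proj (overlap_graph k))"
    using node by (auto simp: overlap_path_def overlap_graph_def simp del: upt_Suc)
  show "overlap_path k n \<pi> \<noteq> []" by (simp add: overlap_path_def)
qed


lemma graph_path_graph: "graph (with_proj (path_graph k n))"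
proof
  show "finite (arcs (with_proj (path_graph k n)))"
    by (rule finite_subset[of _ "{1..n} \<times> {1..n}"]) (auto simp: path_graph_def path_scheme_def)
  show "symmetric (with_proj (path_graph k n))"
    by (auto simp: symmetric_def sym_def path_graph_def path_scheme_def abs_minus_commute)
qed (auto simp: path_graph_def path_scheme_def arc_to_ends_def)

lemma parcs_path_graph_complete:
  "parcs (path_graph n n) = {(x, y). x \<in> {1..n} \<and> y \<in> {1..n} \<and> x \<noteq> y}"
  by (auto simp: path_graph_def path_scheme_def)

lemma directed_hamiltonian_path_mono:
  assumes "k \<le> n" "directed_hamiltonian_path (path_graph k n) p"
  shows "directed_hamiltonian_path (path_graph n n) p"
proof -
  have "parcs (path_graph k n) \<subseteq> parcs (path_graph n n)"
    "pverts (path_graph k n) = pverts (path_graph n n)"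
    using assms(1) by (auto simp: path_graph_def path_scheme_def)
  then show ?thesis using assms(2)
    by (auto simp: directed_hamiltonian_path_def vpath_def vwalk_def)
qed

lemma directed_hamiltonian_path_corresponding:
  assumes "1 \<le> n" "\<sigma> permutes {1..n}"
  shows "directed_hamiltonian_path (path_graph n n) (corresponding_path n \<sigma>)"
proof -
  have im: "set (corresponding_path n \<sigma>) = {1..n}"
    using permutes_image[OF assms(2)]
    by (simp add: corresponding_path_def perm_word_def atLeastLessThanSuc_atLeastAtMost del: upt_Suc)
  have inj: "inj \<sigma>" using permutes_inj[OF assms(2)] .
  have "\<sigma> i \<noteq> \<sigma> (Suc i)" for i by (simp add: inj_eq[OF inj])
  moreover have "\<sigma> i \<in> {1..n}" if "i \<in> {1..n}" for i
    using permutes_in_image[OF assms(2)] that by blast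
  ultimately have "set (vwalk_arcs (corresponding_path n \<sigma>)) \<subseteq> parcs (path_graph n n)"
    unfolding corresponding_path_def perm_word_def vwalk_arcs_map_upt parcs_path_graph_complete
    by force
  moreover have "distinct (corresponding_path n \<sigma>)"
    using inj by (auto simp: corresponding_path_def perm_word_def distinct_map intro: inj_on_subset)
  moreover have "pverts (path_graph n n) = {1..n}" by (simp add: path_graph_def path_scheme_def)
  ultimately show ?thesis using im assms(1)
    by (auto simp: directed_hamiltonian_path_def vpath_def vwalk_def)
qed

end

theory Submission
  imports Defs
begin

text \<open>
  Two permutations have the same path iff they compare any two positions at distance less than
  \<open>k\<close> in the same way.  If consecutive values of \<open>\<pi>\<close> always occupy positions at distance less than
  \<open>k\<close>, then these comparisons order all positions, which determines \<open>\<pi>\<close>.  If instead \<open>v\<close> and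
  \<open>v + 1\<close> occupy positions at distance at least \<open>k\<close>, then exchanging these two values changes no
  comparison within distance less than \<open>k\<close>.  So \<open>\<pi>\<close> is uniquely determined iff consecutive entries
  of the word of its inverse differ by less than \<open>k\<close>, i.e. are adjacent in the path-scheme.
\<close>

text \<open>A distinct word is order-isomorphic to the word of its pattern, so a common pattern
  links \<open>u\<close> to \<open>v\<close>.\<close>

lemma pattern_of_eq_iff:
  assumes "distinct u" "distinct v" "length u = length v"
  shows "pattern_of u = pattern_of v \<longleftrightarrow> order_isomorphic u v"
proof
  assume "pattern_of u = pattern_of v"
  then show "order_isomorphic u v"
    using pattern_of_props(2)[OF assms(1)] pattern_of_props(2)[OF assms(2)] assms(3)
    unfolding order_isomorphic_def by (simp add: perm_word_def del: upt_Suc)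
qed (rule pattern_of_cong)

text \<open>Two positions lie in a common window of length \<open>k\<close> exactly when their
  distance is less than \<open>k\<close>.\<close>

lemma overlap_path_eq_iff:
  assumes "1 \<le> k" "k \<le> n" "inj \<sigma>" "inj \<pi>"
  shows "overlap_path k n \<sigma> = overlap_path k n \<pi> \<longleftrightarrow>
    (\<forall>i\<in>{1..n}. \<forall>j\<in>{1..n}. i < j + k \<and> j < i + k \<longrightarrow> (\<sigma> i < \<sigma> j \<longleftrightarrow> \<pi> i < \<pi> j))"
    (is "_ \<longleftrightarrow> ?R")
proof -
  have dist: "distinct (map f [i..<i+k])" if "inj f" for f :: "nat \<Rightarrow> nat" and i
    using that by (auto simp: distinct_map intro: inj_on_subset)
  have "overlap_path k n \<sigma> = overlap_path k n \<pi> \<longleftrightarrow>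
    (\<forall>s\<in>{1..n-k+1}. order_isomorphic (map \<sigma> [s..<s+k]) (map \<pi> [s..<s+k]))"
    unfolding overlap_path_def
    by (auto simp: pattern_of_eq_iff dist assms(3,4) simp del: upt_Suc)
  also have "\<dots> \<longleftrightarrow>
    (\<forall>s\<in>{1..n-k+1}. \<forall>a<k. \<forall>b<k. \<sigma> (s + a) < \<sigma> (s + b) \<longleftrightarrow> \<pi> (s + a) < \<pi> (s + b))"
    unfolding order_isomorphic_def by (auto simp del: upt_Suc)
  also have "\<dots> \<longleftrightarrow> ?R"
  proof
    assume L: "\<forall>s\<in>{1..n-k+1}. \<forall>a<k. \<forall>b<k. \<sigma> (s + a) < \<sigma> (s + b) \<longleftrightarrow> \<pi> (s + a) < \<pi> (s + b)"
    show ?R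
    proof (intro ballI impI)
      fix i j assume ij: "i \<in> {1..n}" "j \<in> {1..n}" "i < j + k \<and> j < i + k"
      \<comment> \<open>The window starts at the smaller position, but no later than
        \<open>n - k + 1\<close>, the last start for which it fits in the word.\<close>
      define s where "s = min (min i j) (n - k + 1)"
      have "s \<in> {1..n-k+1}" "i - s < k" "j - s < k" "s + (i - s) = i" "s + (j - s) = j"
        using ij assms(2) unfolding s_def by auto
      with L show "\<sigma> i < \<sigma> j \<longleftrightarrow> \<pi> i < \<pi> j" by metis
    qed
  qed (use assms(2) in auto)
  finally show ?thesis .
qed

text \<open>The values start at 1 or more and grow by at least one per step, so no point is lowered;
  such a permutation is the identity.\<close>

lemma permutes_consecutive_less_id:
  fixes \<tau> :: "nat \<Rightarrow> nat"
  assumes "\<tau> permutes {1..n}" "\<And>v. v \<in> {1..<n} \<Longrightarrow> \<tau> v < \<tau> (Suc v)"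
  shows "\<tau> = id"
proof (rule permutes_natset_ge[OF assms(1)], rule ballI)
  fix v assume "v \<in> {1..n}"
  then show "v \<le> \<tau> v"
  proof (induction v)
    case (Suc v)
    show ?case
    \<comment> \<open>The induction starts at 0, outside the interval, so the induction hypothesis
      gives nothing for position 1.\<close>
    proof (cases "v = 0")
      case True
      then show ?thesis using Suc.prems permutes_in_image[OF assms(1), of 1] by simp
    next
      case False
      then show ?thesis using Suc assms(2)[of v] by force
    qed
  qed simp
qed

lemma uniquely_determined_iff:
  assumes "1 \<le> k" "k \<le> n" "\<pi> permutes {1..n}"
  shows "uniquely_determined k n \<pi> \<longleftrightarrow>
    (\<forall>v\<in>{1..<n}. inv \<pi> v < inv \<pi> (Suc v) + k \<and> inv \<pi> (Suc v) < inv \<pi> v + k)"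
    (is "_ \<longleftrightarrow> ?R")
proof -
  note inv_in = permutes_in_image[OF permutes_inv[OF assms(3)]]
  note inv [simp] = permutes_inverses[OF assms(3)]
  note inj_pi = permutes_inj[OF assms(3)]
  show ?thesis
  proof
    assume U: "uniquely_determined k n \<pi>"
    show ?R
    proof (rule ballI, rule ccontr)
      fix v assume v: "v \<in> {1..<n}"
      assume far: "\<not> (inv \<pi> v < inv \<pi> (Suc v) + k \<and> inv \<pi> (Suc v) < inv \<pi> v + k)"
      define \<sigma> where "\<sigma> = transpose v (Suc v) \<circ> \<pi>"
      have perm: "\<sigma> permutes {1..n}"
        unfolding \<sigma>_def
        by (rule permutes_compose[OF assms(3)], rule permutes_swap_id) (use v in auto)
      have "\<sigma> (inv \<pi> v) \<noteq> \<pi> (inv \<pi> v)" by (simp add: \<sigma>_def)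
      then have "\<sigma> \<noteq> \<pi>" by metis
      moreover have "\<sigma> i < \<sigma> j \<longleftrightarrow> \<pi> i < \<pi> j" if "i < j + k \<and> j < i + k" for i j
      proof -
        \<comment> \<open>Exchanging consecutive values reverses only the comparison between those
          two, and their positions are too far apart to be \<open>i\<close> and
          \<open>j\<close>.\<close>
        have "\<not> (\<pi> i = v \<and> \<pi> j = Suc v)" "\<not> (\<pi> i = Suc v \<and> \<pi> j = v)"
          using far that inv(2)[of i] inv(2)[of j] by metis+
        then show ?thesis by (auto simp: \<sigma>_def transpose_def)
      qed
      then have "overlap_path k n \<sigma> = overlap_path k n \<pi>"
        by (subst overlap_path_eq_iff[OF assms(1,2) permutes_inj[OF perm] inj_pi]) blast
      ultimately show False using U perm unfolding uniquely_determined_def by blast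
    qed
  next
    assume R: ?R
    have "\<sigma> = \<pi>" if perm: "\<sigma> permutes {1..n}" and eq: "overlap_path k n \<sigma> = overlap_path k n \<pi>" for \<sigma>
    proof -
      \<comment> \<open>Composing with \<open>inv \<pi>\<close> lists the values of
        \<open>\<sigma>\<close> in the order in which \<open>\<pi>\<close> ranks the
        positions.\<close>
      have "\<sigma> \<circ> inv \<pi> = id"
      proof (rule permutes_consecutive_less_id)
        show "\<sigma> \<circ> inv \<pi> permutes {1..n}"
          by (rule permutes_compose[OF permutes_inv[OF assms(3)] perm])
        fix v assume v: "v \<in> {1..<n}"
        then have "inv \<pi> v \<in> {1..n}" "inv \<pi> (Suc v) \<in> {1..n}" using inv_in by auto
        \<comment> \<open>By \<open>R\<close> the two positions are closer than \<open>k\<close>, so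
          \<open>\<sigma>\<close> compares them as \<open>\<pi>\<close> does.\<close>
        moreover have "\<pi> (inv \<pi> v) < \<pi> (inv \<pi> (Suc v))" by simp
        ultimately show "(\<sigma> \<circ> inv \<pi>) v < (\<sigma> \<circ> inv \<pi>) (Suc v)"
          using R v eq
          unfolding overlap_path_eq_iff[OF assms(1,2) permutes_inj[OF perm] inj_pi] o_apply
          by blast
      qed
      then show ?thesis by (metis inv(2) comp_apply id_apply ext)
    qed
    then show "uniquely_determined k n \<pi>"
      using assms(3) unfolding uniquely_determined_def by blast
  qed
qed

lemma perm_word_inj:
  assumes "\<sigma> permutes {1..n}" "\<tau> permutes {1..n}" "perm_word n \<sigma> = perm_word n \<tau>"
  shows "\<sigma> = \<tau>"
proof
  fix i
  show "\<sigma> i = \<tau> i"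
  proof (cases "i \<in> {1..n}")
    case True
    then show ?thesis using assms(3) by (auto simp: perm_word_def simp del: upt_Suc)
  next
    case False
    then show ?thesis using assms(1,2) by (metis permutes_not_in)
  qed
qed

lemma ex_perm_word:
  assumes "distinct p" "set p = {1..n}"
  obtains \<sigma> where "\<sigma> permutes {1..n}" "perm_word n \<sigma> = p"
proof
  \<comment> \<open>List indices start at 0 and positions at 1, hence the shift; outside
    \<open>{1..n}\<close> a permutation must be the identity.\<close>
  let ?\<sigma> = "\<lambda>i. if i \<in> {1..n} then p ! (i - 1) else i"
  have len: "length p = n" using distinct_card[OF assms(1)] assms(2) by simp
  show pw: "perm_word n ?\<sigma> = p"
    by (rule nth_equalityI) (auto simp: perm_word_def len simp del: upt_Suc)
  have "set (perm_word n ?\<sigma>) = ?\<sigma> ` {1..n}"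
    unfolding perm_word_def by (simp only: set_map set_upt Suc_eq_plus1[symmetric]
        atLeastLessThanSuc_atLeastAtMost)
  then have "?\<sigma> ` {1..n} = {1..n}" using pw assms(2) by simp
  then have "bij_betw ?\<sigma> {1..n} {1..n}" by (simp add: bij_betw_def eq_card_imp_inj_on)
  then show "?\<sigma> permutes {1..n}" by (rule bij_imp_permutes) auto
qed

text \<open>The word is already a hamiltonian path of the complete graph, so only its arcs have to
  be checked.\<close>

lemma directed_hamiltonian_path_iff:
  assumes "1 \<le> k" "k \<le> n" "\<sigma> permutes {1..n}"
  shows "directed_hamiltonian_path (path_graph k n) (perm_word n \<sigma>) \<longleftrightarrow>
    (\<forall>v\<in>{1..<n}. \<sigma> v < \<sigma> (Suc v) + k \<and> \<sigma> (Suc v) < \<sigma> v + k)"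
proof -
  let ?p = "perm_word n \<sigma>"
  have complete: "vpath ?p (with_proj (path_graph n n))" "set ?p = {1..n}"
    using directed_hamiltonian_path_corresponding[OF _ assms(3)] assms(1,2)
    by (auto simp: directed_hamiltonian_path_def corresponding_path_def
        path_graph_def path_scheme_def)
  have "directed_hamiltonian_path (path_graph k n) ?p \<longleftrightarrow>
      set (vwalk_arcs ?p) \<subseteq> parcs (path_graph k n)"
    using complete by (auto simp: directed_hamiltonian_path_def vpath_def vwalk_def
        path_graph_def path_scheme_def)
  also have "\<dots> \<longleftrightarrow> (\<forall>v\<in>{1..<n}. (\<sigma> v, \<sigma> (Suc v)) \<in> parcs (path_graph k n))"
    unfolding perm_word_def vwalk_arcs_map_upt by auto
  also have "\<dots> \<longleftrightarrow> (\<forall>v\<in>{1..<n}. \<sigma> v < \<sigma> (Suc v) + k \<and> \<sigma> (Suc v) < \<sigma> v + k)"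
  proof (rule ball_cong[OF refl])
    fix v assume "v \<in> {1..<n}"
    \<comment> \<open>Adjacency asks for a difference in \<open>{1..k-1}\<close>; injectivity
      excludes 0, which leaves the bound below \<open>k\<close>.\<close>
    then have "\<sigma> v \<in> {1..n}" "\<sigma> (Suc v) \<in> {1..n}" "\<sigma> v \<noteq> \<sigma> (Suc v)"
      using permutes_in_image[OF assms(3)] inj_eq[OF permutes_inj[OF assms(3)]] by auto
    then show "(\<sigma> v, \<sigma> (Suc v)) \<in> parcs (path_graph k n) \<longleftrightarrow>
        \<sigma> v < \<sigma> (Suc v) + k \<and> \<sigma> (Suc v) < \<sigma> v + k"
      using assms(1) by (auto simp: path_graph_def path_scheme_def)
  qed
  finally show ?thesis .
qed

theorem theorem3:
  fixes k n :: nat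
  assumes "1 \<le> k" and "k \<le> n"
  shows "bij_betw (Phi n)
           {\<pi>. uniquely_determined k n \<pi>}
           {p. directed_hamiltonian_path (path_graph k n) p}"
proof (rule bij_betw_imageI)
  have perm: "\<pi> permutes {1..n}" if "uniquely_determined k n \<pi>" for \<pi>
    using that by (simp add: uniquely_determined_def)
  \<comment> \<open>With \<open>inv \<pi>\<close> as \<open>\<sigma>\<close>, the criteria for
    unique determination and for hamiltonian paths are the same inequalities.\<close>
  have key: "uniquely_determined k n \<pi> \<longleftrightarrow> directed_hamiltonian_path (path_graph k n) (Phi n \<pi>)"
    if "\<pi> permutes {1..n}" for \<pi>
    unfolding Phi_def corresponding_path_def uniquely_determined_iff[OF assms that]
      directed_hamiltonian_path_iff[OF assms permutes_inv[OF that]] ..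
  show "inj_on (Phi n) {\<pi>. uniquely_determined k n \<pi>}"
  proof (rule inj_onI, clarify)
    fix \<pi> \<rho>
    assume U: "uniquely_determined k n \<pi>" "uniquely_determined k n \<rho>" and "Phi n \<pi> = Phi n \<rho>"
    then have "inv \<pi> = inv \<rho>"
      unfolding Phi_def corresponding_path_def
      using perm_word_inj[OF permutes_inv[OF perm] permutes_inv[OF perm]] by blast
    then show "\<pi> = \<rho>" using U by (metis perm permutes_inv_inv)
  qed
  have "\<exists>\<pi>. uniquely_determined k n \<pi> \<and> p = Phi n \<pi>"
    if p: "directed_hamiltonian_path (path_graph k n) p" for p
  proof -
    have "distinct p" "set p = {1..n}"
      using p by (auto simp: directed_hamiltonian_path_def vpath_def path_graph_def path_scheme_def)
    then obtain \<sigma> where \<sigma>: "\<sigma> permutes {1..n}" "perm_word n \<sigma> = p"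
      by (rule ex_perm_word)
    \<comment> \<open>\<open>Phi\<close> inverts its argument, so the preimage is
      \<open>inv \<sigma>\<close>.\<close>
    then have "Phi n (inv \<sigma>) = p"
      by (simp add: Phi_def corresponding_path_def permutes_inv_inv)
    then show ?thesis using key[OF permutes_inv[OF \<sigma>(1)]] p by metis
  qed
  then show "Phi n ` {\<pi>. uniquely_determined k n \<pi>} =
      {p. directed_hamiltonian_path (path_graph k n) p}"
    using key perm by auto
qed

end
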